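(* Let $d:E_d\to[0,\infty)$ be a graph metric with vertex set $V_d$ such that the pseudometric space $([V_d]^2,\ddot d)$ contains a separable uncountable subspace $S\subseteq[V_d]^2\setminus E_d$. Then for every ordinal $\lambda$ and every family $\mathcal F$ of subsets of $\mathbb R$ each containing more than one element, player II has a winning strategy in the metric-extending game $\Game_d(\lambda,\mathcal F)$.
   Context: Notation: $[X]^2=\{A\subseteq X:|A|=2\}$; $xy$ denotes $\{x,y\}$. A graph is a set $E$ of 2-element sets with vertex set $\bigcup E$; connected means any two vertices are joined by a finite path of edges. For a function $d:E_d\to[0,\infty)$ on a connected graph $E_d$ with vertex set $V_d$: $\hat d(x,y)=\inf\{\sum_{i=1}^n d(x_{i-1}x_i): x_0=x,\ x_n=y,\ x_{i-1}x_i\in E_d\}$ (with $\hat d(x,x)=0$), and $\ddot d(xy,uv)=\min\{\hat d(x,u)+\hat d(y,v),\hat d(x,v)+\hat d(y,u)\}$ on $[V_d]^2$. A graph pseudometric is such a $d$ with $d(xy)=\hat d(x,y)$ for all $xy\in E_d$; a graph metric additionally has $d(xy)>0$ on $E_d$; a full metric is a graph metric with domain $[V_d]^2$. The metric-extending game $\Game_d(\lambda,\mathcal F)$: at each inning $\alpha\in\lambda$ player I chooses a doubleton $x_\alpha y_\alpha\in[V_d]^2$ and a set $F_\alpha\in\mathcal F$, and player II answers with a real $r_\alpha\in F_\alpha$. Player I wins if $D=d\cup\{\langle x_\alpha y_\alpha,r_\alpha\rangle:\alpha\in\lambda\}$ is a full metric; otherwise player II wins. A strategy of player II is a rule assigning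 to each sequence $(\langle x_\gamma y_\gamma,F_\gamma\rangle)_{\gamma\le\beta}$ ($\beta<\lambda$) of moves of player I an answer $r_\beta\in F_\beta$; it is winning if for every sequence of moves of player I the resulting $D$ is not a full metric. *)

theory Defs
  imports "HOL-Analysis.Analysis" "HOL-Library.Ramsey"
begin

text \<open>
  A graph is a set \<open>E\<close> of two-element sets; its vertex set is \<open>\<Union>E\<close>, and \<open>[X]\<^bsup>2\<^esup>\<close> is
  the library's \<^const>\<open>nsets\<close>.  A function \<open>d : E \<rightarrow> [0,\<infinity>)\<close> is given by the pair of \<open>E\<close> and
  a HOL function \<open>d\<close> of which only the values on \<open>E\<close> are ever used.
\<close>

definition is_graph :: "'a set set \<Rightarrow> bool" where
  "is_graph E \<longleftrightarrow> E \<subseteq> [\<Union>E]\<^bsup>2\<^esup>"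

definition path_in :: "'a set set \<Rightarrow> nat \<Rightarrow> (nat \<Rightarrow> 'a) \<Rightarrow> 'a \<Rightarrow> 'a \<Rightarrow> bool" where
  "path_in E n p x y \<longleftrightarrow> p 0 = x \<and> p n = y \<and> (\<forall>i<n. {p i, p (Suc i)} \<in> E)"

definition connected_graph :: "'a set set \<Rightarrow> bool" where
  "connected_graph E \<longleftrightarrow> is_graph E \<and> (\<forall>x\<in>\<Union>E. \<forall>y\<in>\<Union>E. \<exists>n p. path_in E n p x y)"

text \<open>Paths of length \<open>n = 0\<close> are admitted, which yields the convention that the distance from
  \<open>x\<close> to \<open>x\<close> is \<open>0\<close>.\<close>

definition dhat :: "'a set set \<Rightarrow> ('a set \<Rightarrow> real) \<Rightarrow> 'a \<Rightarrow> 'a \<Rightarrow> real" where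
  "dhat E d x y = Inf {(\<Sum>i<n. d {p i, p (Suc i)}) | n p. path_in E n p x y}"

text \<open>The minimum below runs over all labellings of the two doubletons; by commutativity of
  addition these give just the two sums displayed in the lemma \<open>ddot_doubletons\<close>.\<close>

definition ddot :: "'a set set \<Rightarrow> ('a set \<Rightarrow> real) \<Rightarrow> 'a set \<Rightarrow> 'a set \<Rightarrow> real" where
  "ddot E d e f = Min {dhat E d x u + dhat E d y v | x y u v. e = {x, y} \<and> f = {u, v}}"

lemma ddot_doubletons:
  "ddot E d {x, y} {u, v} =
     min (dhat E d x u + dhat E d y v) (dhat E d x v + dhat E d y u)"
proof -
  have "{dhat E d x' u' + dhat E d y' v' | x' y' u' v'. {x, y} = {x', y'} \<and> {u, v} = {u', v'}}
      = {dhat E d x u + dhat E d y v, dhat E d x v + dhat E d y u}"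
    by (auto simp: doubleton_eq_iff add.commute)
  then show ?thesis
    by (simp add: ddot_def)
qed

text \<open>The topology of the pseudometric space \<open>([\<Union>E]\<^bsup>2\<^esup>, ddot)\<close>, generated by its open balls.\<close>

definition ddot_topology :: "'a set set \<Rightarrow> ('a set \<Rightarrow> real) \<Rightarrow> 'a set topology" where
  "ddot_topology E d =
     topology_generated_by {{f \<in> [\<Union>E]\<^bsup>2\<^esup>. ddot E d e f < r} | e r. e \<in> [\<Union>E]\<^bsup>2\<^esup> \<and> 0 < r}"

definition graph_pseudometric :: "'a set set \<Rightarrow> ('a set \<Rightarrow> real) \<Rightarrow> bool" where
  "graph_pseudometric E d \<longleftrightarrow>
     connected_graph E \<and> (\<forall>e\<in>E. 0 \<le> d e) \<and> (\<forall>x y. {x, y} \<in> E \<longrightarrow> d {x, y} = dhat E d x y)"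

definition graph_metric :: "'a set set \<Rightarrow> ('a set \<Rightarrow> real) \<Rightarrow> bool" where
  "graph_metric E d \<longleftrightarrow> graph_pseudometric E d \<and> (\<forall>e\<in>E. 0 < d e)"

definition full_metric :: "'a set set \<Rightarrow> ('a set \<Rightarrow> real) \<Rightarrow> bool" where
  "full_metric E d \<longleftrightarrow> graph_metric E d \<and> E = [\<Union>E]\<^bsup>2\<^esup>"

definition fun_graph :: "'a set set \<Rightarrow> ('a set \<Rightarrow> real) \<Rightarrow> ('a set \<times> real) set" where
  "fun_graph E d = (\<lambda>e. (e, d e)) ` E"

text \<open>
  The ordinal \<open>\<lambda>\<close> is represented by a well-order \<open>L\<close>, whose field consists of the innings; the
  innings \<open>\<gamma> \<le> \<beta>\<close> are \<open>under L \<beta>\<close>.  A run of player I is a function on \<open>Field L\<close>, and a strategy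
  \<open>\<sigma>\<close> of player II maps an inning \<open>\<beta>\<close> and a sequence of moves defined on the innings
  \<open>\<gamma> \<le> \<beta>\<close> only (an extensional function on \<open>under L \<beta>\<close>) to an answer.
\<close>

definition moves_I :: "'a set set \<Rightarrow> real set set \<Rightarrow> ('a set \<times> real set) set" where
  "moves_I E \<F> = [\<Union>E]\<^bsup>2\<^esup> \<times> \<F>"

definition strategy_II ::
  "'a set set \<Rightarrow> 'i rel \<Rightarrow> real set set \<Rightarrow> ('i \<Rightarrow> ('i \<Rightarrow> 'a set \<times> real set) \<Rightarrow> real) \<Rightarrow> bool" where
  "strategy_II E L \<F> \<sigma> \<longleftrightarrow>
     (\<forall>\<beta>\<in>Field L. \<forall>m \<in> under L \<beta> \<rightarrow>\<^sub>E moves_I E \<F>. \<sigma> \<beta> m \<in> snd (m \<beta>))"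

text \<open>The final object \<open>D\<close> of the game is a set of pairs, as it need not be single-valued: player I
  may choose a doubleton twice, or one that is already in \<open>E\<close>.\<close>

definition outcome ::
  "'a set set \<Rightarrow> ('a set \<Rightarrow> real) \<Rightarrow> 'i rel \<Rightarrow> ('i \<Rightarrow> 'a set \<times> real set) \<Rightarrow> ('i \<Rightarrow> real)
     \<Rightarrow> ('a set \<times> real) set" where
  "outcome E d L m r = fun_graph E d \<union> {(fst (m \<alpha>), r \<alpha>) | \<alpha>. \<alpha> \<in> Field L}"

definition wins_I :: "('a set \<times> real) set \<Rightarrow> bool" where
  "wins_I D \<longleftrightarrow> (\<exists>E' d'. D = fun_graph E' d' \<and> full_metric E' d')"

definition winning_strategy_II ::
  "'a set set \<Rightarrow> ('a set \<Rightarrow> real) \<Rightarrow> 'i rel \<Rightarrow> real set set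
     \<Rightarrow> ('i \<Rightarrow> ('i \<Rightarrow> 'a set \<times> real set) \<Rightarrow> real) \<Rightarrow> bool" where
  "winning_strategy_II E d L \<F> \<sigma> \<longleftrightarrow>
     strategy_II E L \<F> \<sigma> \<and>
     (\<forall>m \<in> Field L \<rightarrow>\<^sub>E moves_I E \<F>.
        \<not> wins_I (outcome E d L m (\<lambda>\<beta>. \<sigma> \<beta> (restrict m (under L \<beta>)))))"

end

(* A full metric D extending d satisfies |D e - D f| <= ddot e f.  Player II answers, whenever
   possible, with a number violating one of these inequalities for an earlier doubleton.  This is
   possible as soon as the new doubleton lies in the ddot-closure of the earlier ones, since then
   at most one number violates nothing.  As each doubleton of S has to be played, and a separable
   pseudometric space has no uncountable well-ordered sequence of points each outside the closure
   of its predecessors, such an inning does occur. *)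
theory Submission
  imports Defs
begin

section \<open>The path pseudometric\<close>

text \<open>An infimum of reals carries information only for a nonempty set bounded below.
  Nonnegative weights give the bound here; connectedness gives nonemptiness in
  \<open>dhat_greatest\<close>.\<close>

lemma bdd_below_path_sums:
  assumes "\<forall>e\<in>E. 0 \<le> d e"
  shows "bdd_below {(\<Sum>i<n. d {p i, p (Suc i)} :: real) | n p. path_in E n p x y}"
  by (rule bdd_belowI[of _ 0]) (use assms in \<open>auto simp: path_in_def intro!: sum_nonneg\<close>)

lemma dhat_le_path:
  assumes "\<forall>e\<in>E. 0 \<le> d e" "path_in E n p x y"
  shows "dhat E d x y \<le> (\<Sum>i<n. d {p i, p (Suc i)})"
  unfolding dhat_def by (rule cInf_lower[OF _ bdd_below_path_sums[OF assms(1)]]) (use assms(2) in blast)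

lemma dhat_greatest:
  assumes "connected_graph E" "x \<in> \<Union>E" "y \<in> \<Union>E"
    and "\<And>n p. path_in E n p x y \<Longrightarrow> c \<le> (\<Sum>i<n. d {p i, p (Suc i)})"
  shows "c \<le> dhat E d x y"
proof -
  obtain n p where "path_in E n p x y"
    using assms(1-3) unfolding connected_graph_def by blast
  then show ?thesis
    unfolding dhat_def by (intro cInf_greatest) (use assms(4) in blast)+
qed

lemma dhat_nonneg:
  assumes "connected_graph E" "\<forall>e\<in>E. 0 \<le> d e" "x \<in> \<Union>E" "y \<in> \<Union>E"
  shows "0 \<le> dhat E d x y"
  by (rule dhat_greatest[OF assms(1,3,4)])
    (use assms(2) in \<open>auto simp: path_in_def intro!: sum_nonneg\<close>)

lemma dhat_refl:
  assumes "connected_graph E" "\<forall>e\<in>E. 0 \<le> d e" "x \<in> \<Union>E"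
  shows "dhat E d x x = 0"
proof (rule antisym)
  show "dhat E d x x \<le> 0"
    using dhat_le_path[OF assms(2), of 0 "\<lambda>_. x" x x] by (simp add: path_in_def)
qed (use dhat_nonneg[OF assms(1,2,3,3)] in auto)

lemma path_in_reverse:
  assumes "path_in E n p x y"
  shows "path_in E n (\<lambda>i. p (n - i)) y x"
    and "(\<Sum>i<n. d {p (n - i), p (n - Suc i)} :: real) = (\<Sum>i<n. d {p i, p (Suc i)})"
proof -
  \<comment> \<open>Truncated subtraction is harmless because i < n gives
    \<open>Suc (n - Suc i) = n - i\<close>; the unordered edge absorbs the change of
    direction.\<close>
  have swap: "{p (n - i), p (n - Suc i)} = {p (n - Suc i), p (Suc (n - Suc i))}" if "i < n" for i
    using that by (simp add: Suc_diff_Suc insert_commute)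
  then show "path_in E n (\<lambda>i. p (n - i)) y x"
    using assms by (auto simp: path_in_def)
  have "(\<Sum>i<n. d {p (n - i), p (n - Suc i)}) = (\<Sum>i<n. d {p (n - Suc i), p (Suc (n - Suc i))})"
    using swap by (intro sum.cong) auto
  also have "\<dots> = (\<Sum>i<n. d {p i, p (Suc i)})"
    by (rule sum.nat_diff_reindex)
  finally show "(\<Sum>i<n. d {p (n - i), p (n - Suc i)}) = (\<Sum>i<n. d {p i, p (Suc i)})" .
qed

lemma dhat_le_commute:
  assumes "connected_graph E" "\<forall>e\<in>E. 0 \<le> d e" "x \<in> \<Union>E" "y \<in> \<Union>E"
  shows "dhat E d x y \<le> dhat E d y x"
proof (rule dhat_greatest[OF assms(1,4,3)])
  fix n p assume p: "path_in E n p y x"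
  show "dhat E d x y \<le> (\<Sum>i<n. d {p i, p (Suc i)})"
    using dhat_le_path[OF assms(2) path_in_reverse(1)[OF p]] path_in_reverse(2)[OF p, of d] by simp
qed

lemma dhat_commute:
  assumes "connected_graph E" "\<forall>e\<in>E. 0 \<le> d e" "x \<in> \<Union>E" "y \<in> \<Union>E"
  shows "dhat E d x y = dhat E d y x"
  using dhat_le_commute[OF assms] dhat_le_commute[OF assms(1,2,4,3)] by (rule antisym)

lemma path_in_append:
  assumes p: "path_in E n p x y" and q: "path_in E k q y z"
  defines "r \<equiv> \<lambda>i. if i \<le> n then p i else q (i - n)"
  shows "path_in E (n + k) r x z"
    and "(\<Sum>i<n + k. d {r i, r (Suc i)} :: real)
       = (\<Sum>i<n. d {p i, p (Suc i)}) + (\<Sum>i<k. d {q i, q (Suc i)})"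
proof -
  have lo: "{r i, r (Suc i)} = {p i, p (Suc i)}" if "i < n" for i
    using that by (simp add: r_def)
  \<comment> \<open>At i = 0 the definition of \<open>r\<close> selects the last vertex of
    \<open>p\<close>, which is y and hence also the first vertex of \<open>q\<close>.\<close>
  have r: "r (n + i) = q i" for i
    using p q by (cases i) (auto simp: r_def path_in_def)
  have hi: "{r (n + i), r (Suc (n + i))} = {q i, q (Suc i)}" for i
    using r[of i] r[of "Suc i"] by simp
  have "{r i, r (Suc i)} \<in> E" if "i < n + k" for i
  proof (cases "i < n")
    case True
    then show ?thesis using lo p by (auto simp: path_in_def)
  next
    case False
    then obtain j where "i = n + j" by (metis le_Suc_ex not_less)
    then show ?thesis using hi q that by (auto simp: path_in_def)
  qed
  moreover have "r 0 = x" "r (n + k) = z"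
    using p q r by (auto simp: path_in_def r_def)
  ultimately show "path_in E (n + k) r x z"
    by (auto simp: path_in_def)
  have "(\<Sum>i<n + k. d {r i, r (Suc i)})
      = (\<Sum>i<n. d {r i, r (Suc i)}) + (\<Sum>i<k. d {r (n + i), r (Suc (n + i))})"
    by (induction k) auto
  also have "(\<Sum>i<n. d {r i, r (Suc i)}) = (\<Sum>i<n. d {p i, p (Suc i)})"
    using lo by (intro sum.cong) auto
  finally show "(\<Sum>i<n + k. d {r i, r (Suc i)})
       = (\<Sum>i<n. d {p i, p (Suc i)}) + (\<Sum>i<k. d {q i, q (Suc i)})"
    by (simp only: hi)
qed

text \<open>Concatenated paths have additive length. The two infima on the right are treated one
  after the other, each time moving the remaining terms to the left so that
  \<open>dhat_greatest\<close> applies.\<close>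

lemma dhat_triangle:
  assumes "connected_graph E" "\<forall>e\<in>E. 0 \<le> d e" "x \<in> \<Union>E" "y \<in> \<Union>E" "z \<in> \<Union>E"
  shows "dhat E d x z \<le> dhat E d x y + dhat E d y z"
proof -
  have "dhat E d x z - dhat E d y z \<le> dhat E d x y"
  proof (rule dhat_greatest[OF assms(1,3,4)])
    fix n p assume p: "path_in E n p x y"
    have "dhat E d x z - (\<Sum>i<n. d {p i, p (Suc i)}) \<le> dhat E d y z"
    proof (rule dhat_greatest[OF assms(1,4,5)])
      fix k q assume q: "path_in E k q y z"
      show "dhat E d x z - (\<Sum>i<n. d {p i, p (Suc i)}) \<le> (\<Sum>i<k. d {q i, q (Suc i)})"
        using dhat_le_path[OF assms(2) path_in_append(1)[OF p q]] path_in_append(2)[OF p q, of d]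
        by linarith
    qed
    then show "dhat E d x z - dhat E d y z \<le> (\<Sum>i<n. d {p i, p (Suc i)})"
      by linarith
  qed
  then show ?thesis by linarith
qed

text \<open>Every path of the smaller graph survives in the larger one with the same length, so the
  infimum there runs over more paths.\<close>

lemma dhat_antimono:
  assumes "connected_graph E" "x \<in> \<Union>E" "y \<in> \<Union>E"
    and "E \<subseteq> E'" "\<forall>e\<in>E'. 0 \<le> d' e" "\<forall>e\<in>E. d' e = d e"
  shows "dhat E' d' x y \<le> dhat E d x y"
proof (rule dhat_greatest[OF assms(1-3)])
  fix n p assume p: "path_in E n p x y"
  then have "path_in E' n p x y"
    using assms(4) by (auto simp: path_in_def)
  from dhat_le_path[OF assms(5) this]
  show "dhat E' d' x y \<le> (\<Sum>i<n. d {p i, p (Suc i)})"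
    using p assms(6) by (simp add: path_in_def)
qed

section \<open>The pseudometric on doubletons\<close>

lemma ddot_refl:
  assumes "connected_graph E" "\<forall>e\<in>E. 0 \<le> d e" "e \<in> [\<Union>E]\<^bsup>2\<^esup>"
  shows "ddot E d e e = 0"
proof -
  obtain x y where e: "e = {x, y}" and V: "x \<in> \<Union>E" "y \<in> \<Union>E"
    using assms(3) by (rule nsets2_E)
  have "0 \<le> dhat E d x y" "0 \<le> dhat E d y x"
    using V by (auto intro!: dhat_nonneg[OF assms(1,2)])
  then show ?thesis
    unfolding e ddot_doubletons using V by (simp add: dhat_refl[OF assms(1,2)])
qed

lemma ddot_commute:
  assumes "connected_graph E" "\<forall>e\<in>E. 0 \<le> d e" "e \<in> [\<Union>E]\<^bsup>2\<^esup>" "f \<in> [\<Union>E]\<^bsup>2\<^esup>"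
  shows "ddot E d e f = ddot E d f e"
proof -
  obtain x y where e: "e = {x, y}" and V: "x \<in> \<Union>E" "y \<in> \<Union>E"
    using assms(3) by (rule nsets2_E)
  obtain u v where f: "f = {u, v}" and W: "u \<in> \<Union>E" "v \<in> \<Union>E"
    using assms(4) by (rule nsets2_E)
  show ?thesis
    unfolding e f ddot_doubletons
    using dhat_commute[OF assms(1,2) V(1) W(1)] dhat_commute[OF assms(1,2) V(1) W(2)]
      dhat_commute[OF assms(1,2) V(2) W(1)] dhat_commute[OF assms(1,2) V(2) W(2)]
    by (simp add: add.commute)
qed

lemma ddot_triangle:
  assumes "connected_graph E" "\<forall>e\<in>E. 0 \<le> d e"
    and "e \<in> [\<Union>E]\<^bsup>2\<^esup>" "f \<in> [\<Union>E]\<^bsup>2\<^esup>" "g \<in> [\<Union>E]\<^bsup>2\<^esup>"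
  shows "ddot E d e g \<le> ddot E d e f + ddot E d f g"
proof -
  obtain x y where e: "e = {x, y}" and V: "x \<in> \<Union>E" "y \<in> \<Union>E"
    using assms(3) by (rule nsets2_E)
  obtain u v where f: "f = {u, v}" and W: "u \<in> \<Union>E" "v \<in> \<Union>E"
    using assms(4) by (rule nsets2_E)
  obtain a b where g: "g = {a, b}" and X: "a \<in> \<Union>E" "b \<in> \<Union>E"
    using assms(5) by (rule nsets2_E)
  note tri = dhat_triangle[OF assms(1,2)]
  \<comment> \<open>A labelling that matches e with f composes with one that matches f with g. The
    eight triangle inequalities cover all four combinations of choices in the two minima.\<close>
  show ?thesis
    unfolding e f g ddot_doubletons
    using tri[OF V(1) W(1) X(1)] tri[OF V(1) W(1) X(2)] tri[OF V(1) W(2) X(1)]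
      tri[OF V(1) W(2) X(2)] tri[OF V(2) W(1) X(1)] tri[OF V(2) W(1) X(2)]
      tri[OF V(2) W(2) X(1)] tri[OF V(2) W(2) X(2)]
    by (auto simp: min_def)
qed

text \<open>In the extension, the detour from x to u, along f to v, and back to y bounds the value
  of e. The two connecting distances can only have shrunk against \<open>dhat E d\<close>, by
  \<open>dhat_antimono\<close>.\<close>

lemma full_metric_le_ddot:
  assumes "connected_graph E" "E \<subseteq> E'" "\<Union>E' = \<Union>E" "full_metric E' d'" "\<forall>e\<in>E. d' e = d e"
    and "e \<in> E'" "f \<in> E'"
  shows "d' e \<le> d' f + ddot E d e f"
proof -
  from assms(4) have E': "E' = [\<Union>E']\<^bsup>2\<^esup>" and c': "connected_graph E'" and n': "\<forall>e\<in>E'. 0 \<le> d' e"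
    and h: "\<And>x y. {x, y} \<in> E' \<Longrightarrow> d' {x, y} = dhat E' d' x y"
    by (auto simp: full_metric_def graph_metric_def graph_pseudometric_def)
  have *: "d' {x, y} \<le> d' {u, v} + (dhat E d x u + dhat E d y v)"
    if xy: "{x, y} \<in> E'" and uv: "{u, v} \<in> E'" for x y u v
  proof -
    have V: "x \<in> \<Union>E'" "y \<in> \<Union>E'" "u \<in> \<Union>E'" "v \<in> \<Union>E'"
      using xy uv by auto
    have "dhat E' d' x y \<le> dhat E' d' x u + (dhat E' d' u v + dhat E' d' v y)"
      using dhat_triangle[OF c' n' V(1,3,2)] dhat_triangle[OF c' n' V(3,4,2)] by linarith
    moreover have "dhat E' d' v y = dhat E' d' y v"
      using V by (intro dhat_commute[OF c' n'])
    moreover have "dhat E' d' x u \<le> dhat E d x u" "dhat E' d' y v \<le> dhat E d y v"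
      using V unfolding assms(3) by (auto intro!: dhat_antimono[OF assms(1) _ _ assms(2) n' assms(5)])
    ultimately show ?thesis
      using h[OF xy] h[OF uv] by linarith
  qed
  obtain x y where e: "e = {x, y}"
    using assms(6) E' by (metis nsets2_E)
  obtain u v where f: "f = {u, v}"
    using assms(7) E' by (metis nsets2_E)
  \<comment> \<open>Swapping the labels of f turns the same estimate into the bound by the other sum
    in the minimum.\<close>
  have "{v, u} = {u, v}" by blast
  then show ?thesis
    using *[of x y u v] *[of x y v u] assms(6,7) unfolding e f ddot_doubletons by (auto simp: min_def)
qed

section \<open>Balls and separability in the space of doubletons\<close>

lemma topspace_ddot_topology:
  assumes "connected_graph E" "\<forall>e\<in>E. 0 \<le> d e"
  shows "topspace (ddot_topology E d) = [\<Union>E]\<^bsup>2\<^esup>"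
proof -
  let ?B = "{{f \<in> [\<Union>E]\<^bsup>2\<^esup>. ddot E d e f < r} | e r. e \<in> [\<Union>E]\<^bsup>2\<^esup> \<and> 0 < r}"
  have "e \<in> \<Union>?B" if e: "e \<in> [\<Union>E]\<^bsup>2\<^esup>" for e
  proof (rule UnionI)
    show "{f \<in> [\<Union>E]\<^bsup>2\<^esup>. ddot E d e f < 1} \<in> ?B"
      using e zero_less_one by blast
    show "e \<in> {f \<in> [\<Union>E]\<^bsup>2\<^esup>. ddot E d e f < 1}"
      using e by (simp add: ddot_refl[OF assms])
  qed
  then show ?thesis
    unfolding ddot_topology_def topology_generated_by_topspace by blast
qed

text \<open>Translates topological density into approximation within every radius: the trace on S of
  a ball around s is a neighbourhood of s, so it meets the dense set.\<close>

lemma separable_ddotE: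
  assumes "connected_graph E" "\<forall>e\<in>E. 0 \<le> d e" "S \<subseteq> [\<Union>E]\<^bsup>2\<^esup>"
    and "separable_space (subtopology (ddot_topology E d) S)"
  obtains C where "countable C" "C \<subseteq> S" "\<And>s r. s \<in> S \<Longrightarrow> 0 < r \<Longrightarrow> \<exists>c\<in>C. ddot E d s c < r"
proof -
  let ?X = "subtopology (ddot_topology E d) S"
  have top: "topspace ?X = S"
    using topspace_ddot_topology[OF assms(1,2)] assms(3) by auto
  obtain C where C: "countable C" "C \<subseteq> S" "?X closure_of C = S"
    using assms(4) top unfolding separable_space_def by auto
  have "\<exists>c\<in>C. ddot E d s c < r" if s: "s \<in> S" and r: "0 < r" for s r
  proof -
    let ?B = "{f \<in> [\<Union>E]\<^bsup>2\<^esup>. ddot E d s f < r}"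
    have "openin (ddot_topology E d) ?B"
      unfolding ddot_topology_def using s r assms(3) by (intro topology_generated_by_Basis) blast
    then have "openin ?X (?B \<inter> S)"
      by (rule openin_subtopology_Int)
    moreover have "s \<in> ?B \<inter> S"
      using s r assms(3) ddot_refl[OF assms(1,2)] by auto
    moreover have "s \<in> ?X closure_of C"
      using s C(3) by simp
    then have "\<forall>T. s \<in> T \<and> openin ?X T \<longrightarrow> (\<exists>c. c \<in> C \<and> c \<in> T)"
      unfolding in_closure_of by (rule conjunct2)
    ultimately have "\<exists>c. c \<in> C \<and> c \<in> ?B \<inter> S"
      by (metis (no_types, lifting))
    then show ?thesis by auto
  qed
  with C that show thesis by blast
qed

text \<open>If each point \<open>s\<close> had distance at least \<open>2 / (n + 1)\<close> from its predecessors, then mapping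
  \<open>s\<close> to \<open>n\<close> and a point of the dense set at distance less than \<open>1 / (n + 1)\<close> would be injective.\<close>

lemma separable_accumulates_at_predecessors:
  assumes "connected_graph E" "\<forall>e\<in>E. 0 \<le> d e" "S \<subseteq> [\<Union>E]\<^bsup>2\<^esup>"
    and "separable_space (subtopology (ddot_topology E d) S)" "uncountable S"
    and total: "\<And>s t. s \<in> S \<Longrightarrow> t \<in> S \<Longrightarrow> s \<noteq> t \<Longrightarrow> prec s t \<or> prec t s"
  shows "\<exists>s\<in>S. \<forall>r>0. \<exists>t\<in>S. prec t s \<and> ddot E d s t < r"
proof (rule ccontr)
  obtain C where C: "countable C" "C \<subseteq> S"
    and dense: "\<And>s r. s \<in> S \<Longrightarrow> 0 < r \<Longrightarrow> \<exists>c\<in>C. ddot E d s c < r"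
    using separable_ddotE[OF assms(1-4)] by metis
  assume "\<not> ?thesis"
  then have *: "\<forall>s\<in>S. \<exists>r>0. \<forall>t\<in>S. prec t s \<longrightarrow> \<not> ddot E d s t < r"
    by blast
  have "\<exists>n. \<exists>c\<in>C. ddot E d s c < 1 / real (Suc n)
      \<and> (\<forall>t\<in>S. prec t s \<longrightarrow> 2 / real (Suc n) \<le> ddot E d s t)"
    if s: "s \<in> S" for s
  proof -
    obtain r where r: "0 < r" "\<And>t. t \<in> S \<Longrightarrow> prec t s \<Longrightarrow> r \<le> ddot E d s t"
      using * s by (metis not_less)
    \<comment> \<open>The scale n is chosen so that 2 / (n + 1) does not exceed the gap r between s
      and its predecessors.\<close>
    obtain n where "inverse (real (Suc n)) < r / 2"
      using reals_Archimedean[of "r / 2"] r(1) by auto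
    then have "2 / real (Suc n) \<le> r"
      by (simp add: field_simps)
    moreover obtain c where "c \<in> C" "ddot E d s c < 1 / real (Suc n)"
      using dense[OF s, of "1 / real (Suc n)"] by auto
    ultimately show ?thesis
      using r(2) by (meson order_trans)
  qed
  then obtain n c where nc: "\<And>s. s \<in> S \<Longrightarrow> c s \<in> C"
      "\<And>s. s \<in> S \<Longrightarrow> ddot E d s (c s) < 1 / real (Suc (n s))"
      "\<And>s t. s \<in> S \<Longrightarrow> t \<in> S \<Longrightarrow> prec t s \<Longrightarrow> 2 / real (Suc (n s)) \<le> ddot E d s t"
    by metis
  have sep: False if st: "s \<in> S" "t \<in> S" "prec t s" "c s = c t" "n s = n t" for s t
  proof -
    have V: "s \<in> [\<Union>E]\<^bsup>2\<^esup>" "t \<in> [\<Union>E]\<^bsup>2\<^esup>" "c t \<in> [\<Union>E]\<^bsup>2\<^esup>"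
      using st nc(1) C(2) assms(3) by blast+
    \<comment> \<open>Both summands are below 1 / (n + 1) for the common n, whereas the gap of s
      requires at least 2 / (n + 1).\<close>
    have "ddot E d s t \<le> ddot E d s (c t) + ddot E d t (c t)"
      using ddot_triangle[OF assms(1,2) V(1,3,2)] ddot_commute[OF assms(1,2) V(2,3)] by simp
    moreover have "2 / real (Suc (n t)) = 1 / real (Suc (n t)) + 1 / real (Suc (n t))"
      by simp
    ultimately show False
      using nc(2)[OF st(1)] nc(2)[OF st(2)] nc(3)[OF st(1-3)] st(4,5) by simp
  qed
  \<comment> \<open>Two distinct points with equal images are comparable, and the later one takes
    the place of s in \<open>sep\<close>.\<close>
  have "inj_on (\<lambda>s. (c s, n s)) S"
    using total sep by (intro inj_onI) (metis Pair_inject)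
  moreover have "countable ((\<lambda>s. (c s, n s)) ` S)"
    by (rule countable_subset[of _ "C \<times> UNIV"]) (use nc(1) C(1) in auto)
  ultimately show False
    using assms(5) countable_image_inj_on by blast
qed

section \<open>The strategy\<close>

text \<open>By \<open>full_metric_le_ddot\<close>, a necessary condition for the answer x at inning
  \<beta> to leave player I a chance, given the earlier answers \<rho>.\<close>

definition compatible ::
  "'a set set \<Rightarrow> ('a set \<Rightarrow> real) \<Rightarrow> 'i rel \<Rightarrow> ('i \<Rightarrow> 'a set \<times> real set) \<Rightarrow> ('i \<Rightarrow> real) \<Rightarrow> 'i \<Rightarrow> real
     \<Rightarrow> bool" where
  "compatible E d L m \<rho> \<beta> x \<longleftrightarrow>
     (\<forall>\<gamma>\<in>underS L \<beta>. \<bar>x - \<rho> \<gamma>\<bar> \<le> ddot E d (fst (m \<beta>)) (fst (m \<gamma>)))"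

text \<open>One step of the recursion for the strategy, with the previous answers \<rho> as a
  parameter. If no element of the offered set spoils the game, any element will do.\<close>

definition answer ::
  "'a set set \<Rightarrow> ('a set \<Rightarrow> real) \<Rightarrow> 'i rel \<Rightarrow> ('i \<Rightarrow> 'a set \<times> real set) \<Rightarrow> ('i \<Rightarrow> real) \<Rightarrow> 'i \<Rightarrow> real"
  where
  "answer E d L m \<rho> \<beta> =
     (if \<exists>x\<in>snd (m \<beta>). \<not> compatible E d L m \<rho> \<beta> x
      then SOME x. x \<in> snd (m \<beta>) \<and> \<not> compatible E d L m \<rho> \<beta> x
      else SOME x. x \<in> snd (m \<beta>))"

text \<open>\<open>L - Id\<close> is the strict order, well-founded for a well-order L. The whole
  run m is an argument, although the answer at \<beta> reads only the moves up to \<beta>; see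
  \<open>spoil_cong\<close>.\<close>

definition spoil ::
  "'a set set \<Rightarrow> ('a set \<Rightarrow> real) \<Rightarrow> 'i rel \<Rightarrow> ('i \<Rightarrow> 'a set \<times> real set) \<Rightarrow> 'i \<Rightarrow> real" where
  "spoil E d L m = wfrec (L - Id) (answer E d L m)"

lemma answer_in:
  assumes "snd (m \<beta>) \<noteq> {}"
  shows "answer E d L m \<rho> \<beta> \<in> snd (m \<beta>)"
  unfolding answer_def using assms
  by (smt (verit, del_insts) ex_in_conv someI_ex)

lemma answer_not_compatible:
  assumes "x \<in> snd (m \<beta>)" "\<not> compatible E d L m \<rho> \<beta> x"
  shows "\<not> compatible E d L m \<rho> \<beta> (answer E d L m \<rho> \<beta>)"
proof -
  have ex: "\<exists>x. x \<in> snd (m \<beta>) \<and> \<not> compatible E d L m \<rho> \<beta> x"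
    using assms by blast
  then show ?thesis
    using someI_ex[OF ex] by (auto simp: answer_def)
qed

text \<open>This locality serves twice: it justifies the recursion equation, and it shows that later
  moves of player I are never consulted.\<close>

lemma answer_cong:
  assumes "m \<beta> = m' \<beta>" "\<And>\<gamma>. \<gamma> \<in> underS L \<beta> \<Longrightarrow> m \<gamma> = m' \<gamma>"
    and "\<And>\<gamma>. \<gamma> \<in> underS L \<beta> \<Longrightarrow> \<rho> \<gamma> = \<rho>' \<gamma>"
  shows "answer E d L m \<rho> \<beta> = answer E d L m' \<rho>' \<beta>"
proof -
  have "compatible E d L m \<rho> \<beta> = compatible E d L m' \<rho>' \<beta>"
    using assms by (auto simp: compatible_def fun_eq_iff)
  then show ?thesis
    by (simp add: answer_def assms(1))
qed

lemma spoil_unfold: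
  assumes "Well_order L"
  shows "spoil E d L m \<beta> = answer E d L m (spoil E d L m) \<beta>"
proof -
  have wf: "wf (L - Id)"
    using assms by (simp add: well_order_on_def)
  show ?thesis
    \<comment> \<open>\<open>wfrec\<close> passes on the earlier answers cut off outside the strict
      predecessors of \<beta>, exactly where \<open>answer\<close> does not look.\<close>
    unfolding spoil_def wfrec[OF wf, of _ \<beta>]
    by (rule answer_cong) (auto simp: cut_def underS_def)
qed

lemma spoil_cong:
  assumes L: "Well_order L" and "\<beta> \<in> Field L" "\<And>\<gamma>. \<gamma> \<in> under L \<beta> \<Longrightarrow> m \<gamma> = m' \<gamma>"
  shows "spoil E d L m \<beta> = spoil E d L m' \<beta>"
proof -
  have wf: "wf (L - Id)" and tr: "trans L" and rf: "refl_on (Field L) L"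
    using L by (auto simp: order_on_defs)
  show ?thesis
    using wf assms(2,3)
  proof (induction \<beta> rule: wf_induct_rule)
    case (less \<beta>)
    show ?case
      unfolding spoil_unfold[OF L, of _ _ _ \<beta>]
    proof (rule answer_cong)
      show "m \<beta> = m' \<beta>"
        using less.prems rf by (auto simp: under_def refl_on_def)
    next
      fix \<gamma> assume \<gamma>: "\<gamma> \<in> underS L \<beta>"
      then show "m \<gamma> = m' \<gamma>"
        using less.prems by (auto simp: under_def underS_def)
      show "spoil E d L m \<gamma> = spoil E d L m' \<gamma>"
      proof (rule less.IH)
        show "(\<gamma>, \<beta>) \<in> L - Id" "\<gamma> \<in> Field L"
          using \<gamma> by (auto simp: underS_def Field_def)
        \<comment> \<open>By transitivity the initial segment up to \<gamma> lies inside the one up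
          to \<beta>.\<close>
        show "m \<delta> = m' \<delta>" if "\<delta> \<in> under L \<gamma>" for \<delta>
          using that \<gamma> less.prems(2) transD[OF tr] by (auto simp: under_def underS_def)
      qed
    qed
  qed
qed

section \<open>The strategy defeats every run of player I\<close>

theorem theorem1p10:
  fixes E :: "'a set set" and d :: "'a set \<Rightarrow> real" and S :: "'a set set"
    and L :: "'i rel" and \<F> :: "real set set"
  assumes "graph_metric E d"
    and "S \<subseteq> [\<Union>E]\<^bsup>2\<^esup> - E"
    and "uncountable S"
    and "separable_space (subtopology (ddot_topology E d) S)"
    and "Well_order L"
    and "\<forall>F\<in>\<F>. \<exists>a\<in>F. \<exists>b\<in>F. a \<noteq> b"
  shows "\<exists>\<sigma>. winning_strategy_II E d L \<F> \<sigma>"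
proof (rule exI[of _ "\<lambda>\<beta> m. spoil E d L m \<beta>"], unfold winning_strategy_II_def, intro conjI ballI)
  have refl: "\<beta> \<in> under L \<beta>" if "\<beta> \<in> Field L" for \<beta>
    using assms(5) that by (auto simp: order_on_defs refl_on_def under_def)
  show "strategy_II E L \<F> (\<lambda>\<beta> m. spoil E d L m \<beta>)"
    unfolding strategy_II_def
  proof (intro ballI)
    fix \<beta> m assume \<beta>: "\<beta> \<in> Field L" and m: "m \<in> under L \<beta> \<rightarrow>\<^sub>E moves_I E \<F>"
    have "snd (m \<beta>) \<in> \<F>"
      using PiE_mem[OF m refl[OF \<beta>]] by (auto simp: moves_I_def)
    then show "spoil E d L m \<beta> \<in> snd (m \<beta>)"
      unfolding spoil_unfold[OF assms(5), of _ _ _ \<beta>] using assms(6) by (intro answer_in) blast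
  qed
next
  fix m assume m: "m \<in> Field L \<rightarrow>\<^sub>E moves_I E \<F>"
  let ?\<rho> = "spoil E d L m"
  have cg: "connected_graph E" and nonneg: "\<forall>e\<in>E. 0 \<le> d e"
    using assms(1) by (auto simp: graph_metric_def graph_pseudometric_def)
  have SV: "S \<subseteq> [\<Union>E]\<^bsup>2\<^esup>"
    using assms(2) by blast
  have mV: "fst (m \<alpha>) \<in> [\<Union>E]\<^bsup>2\<^esup>" "snd (m \<alpha>) \<in> \<F>" if "\<alpha> \<in> Field L" for \<alpha>
    using PiE_mem[OF m that] by (auto simp: moves_I_def)
  \<comment> \<open>At each inning the strategy sees only an initial segment of the run, yet its
    answers are those of one recursion along the whole run.\<close>
  have "spoil E d L (restrict m (under L \<beta>)) \<beta> = ?\<rho> \<beta>" if "\<beta> \<in> Field L" for \<beta>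
    by (rule spoil_cong[OF assms(5) that]) auto
  then have out: "outcome E d L m (\<lambda>\<beta>. spoil E d L (restrict m (under L \<beta>)) \<beta>)
      = fun_graph E d \<union> (\<lambda>\<alpha>. (fst (m \<alpha>), ?\<rho> \<alpha>)) ` Field L"
    by (force simp: outcome_def)
  show "\<not> wins_I (outcome E d L m (\<lambda>\<beta>. spoil E d L (restrict m (under L \<beta>)) \<beta>))"
  proof
    assume "wins_I (outcome E d L m (\<lambda>\<beta>. spoil E d L (restrict m (under L \<beta>)) \<beta>))"
    then obtain E' d' where full: "full_metric E' d'"
      and D: "fun_graph E' d' = fun_graph E d \<union> (\<lambda>\<alpha>. (fst (m \<alpha>), ?\<rho> \<alpha>)) ` Field L"
      unfolding wins_I_def out by metis
    have "fst ` fun_graph E' d' = E'" "fst ` fun_graph E d = E"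
      by (auto simp: fun_graph_def image_image)
    then have E': "E' = E \<union> (\<lambda>\<alpha>. fst (m \<alpha>)) ` Field L"
      unfolding D by (simp add: image_Un image_image)
    \<comment> \<open>Since D is the graph of a function, it is single-valued, so \<open>d'\<close>
      must agree with d on E and with every answer, even for repeated doubletons.\<close>
    have "(e, d e) \<in> fun_graph E' d'" if "e \<in> E" for e
      using that unfolding D by (auto simp: fun_graph_def)
    then have d': "\<forall>e\<in>E. d' e = d e"
      by (force simp: fun_graph_def)
    have "(fst (m \<alpha>), ?\<rho> \<alpha>) \<in> fun_graph E' d'" if "\<alpha> \<in> Field L" for \<alpha>
      using that unfolding D by auto
    then have \<rho>: "d' (fst (m \<alpha>)) = ?\<rho> \<alpha>" if "\<alpha> \<in> Field L" for \<alpha>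
      using that by (force simp: fun_graph_def)
    \<comment> \<open>Player I chooses pairs of old vertices, so no vertex is added.\<close>
    have "\<Union>E' = \<Union>E"
      using mV(1) unfolding E' by (auto simp: nsets_def)
    then have E'2: "E' = [\<Union>E]\<^bsup>2\<^esup>"
      using full by (simp add: full_metric_def)
    have close: "\<bar>?\<rho> \<alpha> - ?\<rho> \<gamma>\<bar> \<le> ddot E d (fst (m \<alpha>)) (fst (m \<gamma>))"
      if "\<alpha> \<in> Field L" "\<gamma> \<in> Field L" for \<alpha> \<gamma>
    proof -
      note le = full_metric_le_ddot[OF cg _ \<open>\<Union>E' = \<Union>E\<close> full d']
      have "fst (m \<alpha>) \<in> E'" "fst (m \<gamma>) \<in> E'"
        using that E' by auto
      then show ?thesis
        using le[of "fst (m \<alpha>)" "fst (m \<gamma>)"] le[of "fst (m \<gamma>)" "fst (m \<alpha>)"] E'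
          ddot_commute[OF cg nonneg mV(1)[OF that(1)] mV(1)[OF that(2)]]
          \<rho>[OF that(1)] \<rho>[OF that(2)] by auto
    qed
    \<comment> \<open>A full metric has all doubletons in its domain, and those of S are missing
      from E; so each was played. \<open>\<tau>\<close> picks an inning for each and thereby pulls
      the order of the innings back to S.\<close>
    have "\<forall>s\<in>S. \<exists>\<alpha>. \<alpha> \<in> Field L \<and> fst (m \<alpha>) = s"
      using assms(2) E' E'2 by blast
    then obtain \<tau> where \<tau>: "\<And>s. s \<in> S \<Longrightarrow> \<tau> s \<in> Field L" "\<And>s. s \<in> S \<Longrightarrow> fst (m (\<tau> s)) = s"
      by metis
    have "total_on (Field L) L"
      using assms(5) by (auto simp: order_on_defs)
    moreover have "\<tau> s \<noteq> \<tau> t" if "s \<in> S" "t \<in> S" "s \<noteq> t" for s t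
      using that \<tau>(2) by metis
    ultimately have total: "\<tau> s \<in> underS L (\<tau> t) \<or> \<tau> t \<in> underS L (\<tau> s)"
      if "s \<in> S" "t \<in> S" "s \<noteq> t" for s t
      using that \<tau>(1) by (simp add: total_on_def underS_def)
    obtain s where s: "s \<in> S"
      and acc: "\<forall>r>0. \<exists>t\<in>S. \<tau> t \<in> underS L (\<tau> s) \<and> ddot E d s t < r"
      using separable_accumulates_at_predecessors
        [where prec = "\<lambda>s t. \<tau> s \<in> underS L (\<tau> t)", OF cg nonneg SV assms(4,3) total] by blast
    obtain a b where ab: "a \<in> snd (m (\<tau> s))" "b \<in> snd (m (\<tau> s))" "a \<noteq> b"
      using assms(6) mV(2)[OF \<tau>(1)[OF s]] by metis
    have "\<not> compatible E d L m ?\<rho> (\<tau> s) a \<or> \<not> compatible E d L m ?\<rho> (\<tau> s) b"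
    proof (rule ccontr)
      assume "\<not> ?thesis"
      then have c: "compatible E d L m ?\<rho> (\<tau> s) a" "compatible E d L m ?\<rho> (\<tau> s) b"
        by auto
      \<comment> \<open>If a and b were both within less than half their distance of the same
        earlier answer, the triangle inequality would make their distance less than itself.\<close>
      obtain t where t: "t \<in> S" "\<tau> t \<in> underS L (\<tau> s)" "ddot E d s t < \<bar>a - b\<bar> / 2"
        using acc[rule_format, of "\<bar>a - b\<bar> / 2"] ab(3) by auto
      then have "\<bar>a - ?\<rho> (\<tau> t)\<bar> \<le> ddot E d s t" "\<bar>b - ?\<rho> (\<tau> t)\<bar> \<le> ddot E d s t"
        using c s \<tau>(2) unfolding compatible_def by metis+
      with t(3) show False
        by (auto simp: field_simps)
    qed
    \<comment> \<open>An incompatible option was on offer at inning \<open>\<tau> s\<close>, so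
      \<open>answer\<close> took one; but \<open>close\<close> forces every answer in a full metric
      to be compatible.\<close>
    then have "\<not> compatible E d L m ?\<rho> (\<tau> s) (?\<rho> (\<tau> s))"
      unfolding spoil_unfold[OF assms(5), of _ _ _ "\<tau> s"]
      using answer_not_compatible ab(1,2) by metis
    moreover have "compatible E d L m ?\<rho> (\<tau> s) (?\<rho> (\<tau> s))"
      unfolding compatible_def
      using close \<tau>(1)[OF s] by (auto simp: underS_def Field_def)
    ultimately show False by blast
  qed
qed

end
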